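(* Let $X$ be a real Banach space and let $\kappa$ be an infinite cardinal. The following are equivalent: (1) $X$ is $\mathrm{ASQ}_{<\kappa}$; (2) $X\times\{0\}$ is a $\kappa$ almost isometric ideal in $X\oplus_\infty\mathbb R$.
   Context: For a normed space $Z$, $\operatorname{dens}(Z)$ is the least cardinality of a subset of $Z$ whose linear span is dense in $Z$ (so it equals $\dim Z$ if $Z$ is finite dimensional); $S_Z$ is its unit sphere. $X\oplus_\infty\mathbb R$ is $X\times\mathbb R$ with norm $\|(x,\lambda)\|=\max\{\|x\|,|\lambda|\}$. A subspace $Y$ of a Banach space $W$ is a $\kappa$ almost isometric ideal in $W$ if for every subspace $E\subseteq W$ with $\operatorname{dens}(E)<\kappa$ and every $\varepsilon>0$ there is a linear operator $T:E\to Y$ with $(1-\varepsilon)\|e\|\le\|T(e)\|\le(1+\varepsilon)\|e\|$ for all $e\in E$ and $T(e)=e$ for all $e\in E\cap Y$. $X$ is $<\kappa$-almost square ($\mathrm{ASQ}_{<\kappa}$) if for every subspace $Z\subseteq X$ with $\operatorname{dens}(Z)<\kappa$ and every $\varepsilon>0$ there is $x\in S_X$ such that $\|z+\lambda x\|\le(1+\varepsilon)\max\{\|z\|,|\lambda|\}$ for all $z\in Z$ and $\lambda\in\mathbb R$. *)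

theory Defs
  imports "HOL-Analysis.Analysis"
begin

unbundle cardinal_syntax

text \<open>The library's product type of two normed spaces carries the Euclidean norm, so a separate
  type is used for the sum equipped with the maximum norm.\<close>

datatype ('a, 'b) sup_sum = SupPair (supfst: 'a) (supsnd: 'b)

lemma sup_sum_eq_iff: "z = w \<longleftrightarrow> supfst z = supfst w \<and> supsnd z = supsnd w"
  by (cases z; cases w) simp

instantiation sup_sum :: (real_vector, real_vector) real_vector
begin

definition zero_sup_sum :: "('a, 'b) sup_sum"
  where "0 = SupPair 0 0"

definition plus_sup_sum :: "('a, 'b) sup_sum \<Rightarrow> ('a, 'b) sup_sum \<Rightarrow> ('a, 'b) sup_sum"
  where "z + w = SupPair (supfst z + supfst w) (supsnd z + supsnd w)"

definition uminus_sup_sum :: "('a, 'b) sup_sum \<Rightarrow> ('a, 'b) sup_sum"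
  where "- z = SupPair (- supfst z) (- supsnd z)"

definition minus_sup_sum :: "('a, 'b) sup_sum \<Rightarrow> ('a, 'b) sup_sum \<Rightarrow> ('a, 'b) sup_sum"
  where "z - w = SupPair (supfst z - supfst w) (supsnd z - supsnd w)"

definition scaleR_sup_sum :: "real \<Rightarrow> ('a, 'b) sup_sum \<Rightarrow> ('a, 'b) sup_sum"
  where "r *\<^sub>R z = SupPair (r *\<^sub>R supfst z) (r *\<^sub>R supsnd z)"

instance
  by standard
    (simp_all add: zero_sup_sum_def plus_sup_sum_def uminus_sup_sum_def minus_sup_sum_def
      scaleR_sup_sum_def sup_sum_eq_iff algebra_simps)

end

lemma supfst_simps [simp]:
  "supfst 0 = 0" "supfst (z + w) = supfst z + supfst w" "supfst (- z) = - supfst z"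
  "supfst (z - w) = supfst z - supfst w" "supfst (r *\<^sub>R z) = r *\<^sub>R supfst z"
  by (simp_all add: zero_sup_sum_def plus_sup_sum_def uminus_sup_sum_def minus_sup_sum_def
      scaleR_sup_sum_def)

lemma supsnd_simps [simp]:
  "supsnd 0 = 0" "supsnd (z + w) = supsnd z + supsnd w" "supsnd (- z) = - supsnd z"
  "supsnd (z - w) = supsnd z - supsnd w" "supsnd (r *\<^sub>R z) = r *\<^sub>R supsnd z"
  by (simp_all add: zero_sup_sum_def plus_sup_sum_def uminus_sup_sum_def minus_sup_sum_def
      scaleR_sup_sum_def)

instantiation sup_sum :: (real_normed_vector, real_normed_vector) real_normed_vector
begin

definition norm_sup_sum :: "('a, 'b) sup_sum \<Rightarrow> real"
  where "norm z = max (norm (supfst z)) (norm (supsnd z))"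

definition dist_sup_sum :: "('a, 'b) sup_sum \<Rightarrow> ('a, 'b) sup_sum \<Rightarrow> real"
  where "dist_sup_sum z w = norm (z - w)"

definition sgn_sup_sum :: "('a, 'b) sup_sum \<Rightarrow> ('a, 'b) sup_sum"
  where "sgn_sup_sum z = inverse (norm z) *\<^sub>R z"

definition uniformity_sup_sum :: "(('a, 'b) sup_sum \<times> ('a, 'b) sup_sum) filter"
  where "uniformity_sup_sum = (INF e\<in>{0<..}. principal {(z, w). dist z w < e})"

definition open_sup_sum :: "('a, 'b) sup_sum set \<Rightarrow> bool"
  where "open_sup_sum U \<longleftrightarrow>
    (\<forall>z\<in>U. eventually (\<lambda>(z', w). z' = z \<longrightarrow> w \<in> U) uniformity)"

instance
proof
  fix r :: real and z w :: "('a, 'b) sup_sum" and U :: "('a, 'b) sup_sum set"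
  show "dist z w = norm (z - w)"
    by (rule dist_sup_sum_def)
  show "sgn z = inverse (norm z) *\<^sub>R z"
    by (rule sgn_sup_sum_def)
  show "(uniformity :: (('a, 'b) sup_sum \<times> ('a, 'b) sup_sum) filter) =
      (INF e\<in>{0<..}. principal {(z, w). dist z w < e})"
    by (rule uniformity_sup_sum_def)
  show "open U = (\<forall>z\<in>U. eventually (\<lambda>(z', w). z' = z \<longrightarrow> w \<in> U) uniformity)"
    by (rule open_sup_sum_def)
  show "norm z = 0 \<longleftrightarrow> z = 0"
    by (auto simp: norm_sup_sum_def sup_sum_eq_iff max_def)
  show "norm (z + w) \<le> norm z + norm w"
    using norm_triangle_ineq[of "supfst z" "supfst w"] norm_triangle_ineq[of "supsnd z" "supsnd w"]
    by (auto simp: norm_sup_sum_def max_def)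
  show "norm (r *\<^sub>R z) = \<bar>r\<bar> * norm z"
    by (simp add: norm_sup_sum_def max_mult_distrib_left)
qed

end

instance sup_sum :: (banach, banach) banach
proof
  fix F :: "nat \<Rightarrow> ('a, 'b) sup_sum"
  assume F: "Cauchy F"
  have fst_le: "dist (supfst z) (supfst w) \<le> dist z w"
    and snd_le: "dist (supsnd z) (supsnd w) \<le> dist z w" for z w :: "('a, 'b) sup_sum"
    by (simp_all add: dist_norm norm_sup_sum_def)
  have "Cauchy (\<lambda>n. supfst (F n))" and "Cauchy (\<lambda>n. supsnd (F n))"
    using F unfolding Cauchy_def by (blast intro: le_less_trans[OF fst_le] le_less_trans[OF snd_le])+
  then obtain a b where a: "(\<lambda>n. supfst (F n)) \<longlonglongrightarrow> a" and b: "(\<lambda>n. supsnd (F n)) \<longlonglongrightarrow> b"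
    using Cauchy_convergent[of "\<lambda>n. supfst (F n)"] Cauchy_convergent[of "\<lambda>n. supsnd (F n)"]
    by (auto simp: convergent_def)
  have "(\<lambda>n. max (norm (supfst (F n) - a)) (norm (supsnd (F n) - b))) \<longlonglongrightarrow> max 0 0"
    using a b by (intro tendsto_max tendsto_norm_zero LIM_zero)
  then have "(\<lambda>n. norm (F n - SupPair a b)) \<longlonglongrightarrow> 0"
    by (simp add: norm_sup_sum_def)
  then have "F \<longlonglongrightarrow> SupPair a b"
    by (rule LIM_zero_cancel[OF tendsto_norm_zero_cancel])
  then show "convergent F"
    by (rule convergentI)
qed

definition spans_densely :: "'a::real_normed_vector set \<Rightarrow> 'a set \<Rightarrow> bool"
  where "spans_densely A Z \<longleftrightarrow> A \<subseteq> Z \<and> Z \<subseteq> closure (span A)"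

text \<open>A cardinal is represented by a cardinal order relation; the minimum below is attained because
  cardinals are well-ordered.\<close>

definition dens :: "'a::real_normed_vector set \<Rightarrow> 'a rel"
  where "dens Z =
    |SOME A. spans_densely A Z \<and> (\<forall>B. spans_densely B Z \<longrightarrow> |A| \<le>o |B| )|"

lemma dens_attained:
  fixes Z :: "'a::real_normed_vector set"
  obtains A where "spans_densely A Z" and "dens Z = |A|"
    and "\<And>B. spans_densely B Z \<Longrightarrow> |A| \<le>o |B|"
proof -
  let ?R = "{ |A| | A. spans_densely A Z}"
  have "spans_densely Z Z"
    using order_trans[OF span_superset closure_subset] by (auto simp: spans_densely_def)
  then have "?R \<noteq> {}"
    by auto
  moreover have "\<forall>r\<in>?R. Card_order r"
    using card_of_Card_order by blast
  ultimately have "\<exists>r\<in>?R. \<forall>r'\<in>?R. r \<le>o r'"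
    by (intro exists_minim_Card_order)
  then have "\<exists>A. spans_densely A Z \<and> (\<forall>B. spans_densely B Z \<longrightarrow> |A| \<le>o |B| )"
    by blast
  from someI_ex[OF this] show thesis
    by (intro that) (auto simp: dens_def)
qed

lemma dens_less_iff:
  fixes \<kappa> :: "'k rel"
  shows "dens Z <o \<kappa> \<longleftrightarrow> (\<exists>A. spans_densely A Z \<and> |A| <o \<kappa>)"
proof -
  obtain A where A: "spans_densely A Z" "dens Z = |A|"
    and least: "\<And>B. spans_densely B Z \<Longrightarrow> |A| \<le>o |B|"
    using dens_attained[of Z] by blast
  show ?thesis
    unfolding A(2) using A(1) ordLeq_ordLess_trans[OF least] by blast
qed

definition ASQ_less :: "'a::banach itself \<Rightarrow> 'k rel \<Rightarrow> bool"
  where "ASQ_less _ \<kappa> \<longleftrightarrow>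
    (\<forall>(Z :: 'a set) \<epsilon>. subspace Z \<and> dens Z <o \<kappa> \<and> \<epsilon> > 0 \<longrightarrow>
      (\<exists>x\<in>sphere 0 1. \<forall>z\<in>Z. \<forall>t::real. norm (z + t *\<^sub>R x) \<le> (1 + \<epsilon>) * max (norm z) \<bar>t\<bar>))"

text \<open>Linearity is required on the subspace only; the values of the map elsewhere are irrelevant.\<close>

definition linear_operator_on :: "'v::real_vector set \<Rightarrow> 'w::real_vector set \<Rightarrow> ('v \<Rightarrow> 'w) \<Rightarrow> bool"
  where "linear_operator_on E Y T \<longleftrightarrow>
    (\<forall>e\<in>E. T e \<in> Y) \<and>
    (\<forall>e\<in>E. \<forall>e'\<in>E. T (e + e') = T e + T e') \<and>
    (\<forall>c. \<forall>e\<in>E. T (c *\<^sub>R e) = c *\<^sub>R T e)"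

definition almost_isometric_ideal :: "'k rel \<Rightarrow> 'w::banach set \<Rightarrow> bool"
  where "almost_isometric_ideal \<kappa> Y \<longleftrightarrow>
    subspace Y \<and>
    (\<forall>E \<epsilon>. subspace E \<and> dens E <o \<kappa> \<and> \<epsilon> > 0 \<longrightarrow>
      (\<exists>T. linear_operator_on E Y T \<and>
        (\<forall>e\<in>E. (1 - \<epsilon>) * norm e \<le> norm (T e) \<and> norm (T e) \<le> (1 + \<epsilon>) * norm e) \<and>
        (\<forall>e\<in>E \<inter> Y. T e = e)))"

end

theory Submission
  imports Defs
begin

text \<open>
  A unit vector \<open>x\<close> is a witness for almost squareness on a subspace \<open>Z\<close> exactly when
  \<open>(z, t) \<mapsto> z + t x\<close> is almost isometric from \<open>Z \<oplus>\<^sub>\<infinity> \<real>\<close> into \<open>X\<close>, and a linear operator on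
  \<open>Z \<oplus>\<^sub>\<infinity> \<real>\<close> with values in \<open>X\<close> that fixes \<open>Z\<close> is of this form, with \<open>x\<close> the image of \<open>(0, 1)\<close>.
  The equivalence is this dictionary, together with three observations.

  Almost squareness provides the upper estimate only, but the upper estimate at \<open>(z, - t)\<close>
  and the triangle inequality give the lower one at \<open>(z, t)\<close> (\<open>norm_add_scaleR_ge\<close>).
  The image of \<open>(0, 1)\<close> under an almost isometric operator is only close to the unit sphere, and normalizing it costs a factor
  \<open>(1 + \<delta>) / (1 - \<delta>)\<close>, which is as close to \<open>1\<close> as desired. Finally, passing between a subspace
  \<open>E\<close> of \<open>X \<oplus>\<^sub>\<infinity> \<real>\<close> and its projection \<open>Z\<close>, or between \<open>Z\<close> and \<open>Z \<oplus>\<^sub>\<infinity> \<real>\<close>, keeps the density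
  character below \<open>\<kappa>\<close>: it does not grow under bounded linear maps
  (\<open>dens_bounded_linear_image_less\<close>), and since \<open>\<kappa>\<close> is infinite a sum of two subspaces of
  density character less than \<open>\<kappa>\<close> is again of this kind (\<open>dens_sum_less\<close>).
\<close>

lemma dens_bounded_linear_image_less:
  fixes \<kappa> :: "'k rel"
  assumes f: "bounded_linear f" and "dens Z <o \<kappa>"
  shows "dens (f ` Z) <o \<kappa>"
proof -
  obtain A where A: "A \<subseteq> Z" "Z \<subseteq> closure (span A)" and card: "|A| <o \<kappa>"
    using assms(2) unfolding dens_less_iff spans_densely_def by blast
  have "f ` closure (span A) \<subseteq> closure (f ` span A)"
    by (rule closure_bounded_linear_image_subset[OF f])
  also have "f ` span A = span (f ` A)"
    using bounded_linear.linear[OF f] by (rule linear_span_image[symmetric])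
  finally have "spans_densely (f ` A) (f ` Z)"
    using A unfolding spans_densely_def by blast
  moreover have "|f ` A| <o \<kappa>"
    using card_of_image card by (rule ordLeq_ordLess_trans)
  ultimately show ?thesis
    unfolding dens_less_iff by blast
qed

lemma dens_sum_less:
  fixes \<kappa> :: "'k rel"
  assumes \<kappa>: "Cinfinite \<kappa>" and "subspace Z" "subspace W" and "dens Z <o \<kappa>" "dens W <o \<kappa>"
  shows "dens {z + w | z w. z \<in> Z \<and> w \<in> W} <o \<kappa>"
proof -
  obtain A where A: "A \<subseteq> Z" "Z \<subseteq> closure (span A)" "|A| <o \<kappa>"
    using assms(4) unfolding dens_less_iff spans_densely_def by blast
  obtain B where B: "B \<subseteq> W" "W \<subseteq> closure (span B)" "|B| <o \<kappa>"
    using assms(5) unfolding dens_less_iff spans_densely_def by blast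
  have "{z + w | z w. z \<in> Z \<and> w \<in> W} \<subseteq> closure (span A) + closure (span B)"
    using A(2) B(2) by (auto simp: set_plus_def)
  also have "\<dots> \<subseteq> closure (span A + span B)"
    by (rule closure_sum)
  also have "span A + span B = span (A \<union> B)"
    by (auto simp: span_Un set_plus_def)
  finally have "{z + w | z w. z \<in> Z \<and> w \<in> W} \<subseteq> closure (span (A \<union> B))" .
  moreover have "A \<union> B \<subseteq> {z + w | z w. z \<in> Z \<and> w \<in> W}"
  proof
    fix x assume "x \<in> A \<union> B"
    then have "x = x + 0 \<and> x \<in> Z \<or> x = 0 + x \<and> x \<in> W"
      using A(1) B(1) by auto
    then show "x \<in> {z + w | z w. z \<in> Z \<and> w \<in> W}"
      using subspace_0[OF \<open>subspace Z\<close>] subspace_0[OF \<open>subspace W\<close>] by blast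
  qed
  moreover have "|A \<union> B| <o \<kappa>"
    using \<kappa> A(3) B(3) by (intro card_of_Un_ordLess_infinite_Field) (auto simp: cinfinite_def)
  ultimately show ?thesis
    unfolding dens_less_iff spans_densely_def by blast
qed

lemma dens_line_less:
  fixes \<kappa> :: "'k rel"
  assumes "Cinfinite \<kappa>"
  shows "dens (span {v}) <o \<kappa>"
proof -
  have "spans_densely {v} (span {v})"
    unfolding spans_densely_def using closure_subset by (auto intro: span_base)
  moreover have "|{v}| <o \<kappa>"
    using assms card_of_Well_order card_order_on_well_order_on[of "Field \<kappa>" \<kappa>]
    by (intro finite_ordLess_infinite) (simp_all add: cinfinite_def Field_card_of)
  ultimately show ?thesis
    unfolding dens_less_iff by blast
qed

text \<open>The larger of \<open>2 z\<close> and \<open>2 t x\<close> is the sum or the difference of \<open>z + t x\<close> and \<open>z - t x\<close>.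
  The norm of the second is at most about half of the larger of \<open>2 \<parallel>z\<parallel>\<close> and \<open>2 |t|\<close>, so the first
  must make up the other half.\<close>

lemma norm_add_scaleR_ge:
  fixes x z :: "'a::real_normed_vector"
  assumes "norm x = 1" and upper: "norm (z - t *\<^sub>R x) \<le> (1 + \<delta>) * max (norm z) \<bar>t\<bar>"
  shows "(1 - \<delta>) * max (norm z) \<bar>t\<bar> \<le> norm (z + t *\<^sub>R x)"
proof -
  have "norm (2 *\<^sub>R z) \<le> norm (z + t *\<^sub>R x) + norm (z - t *\<^sub>R x)"
    using norm_triangle_ineq[of "z + t *\<^sub>R x" "z - t *\<^sub>R x"] by (simp add: scaleR_2)
  moreover have "norm ((2 * t) *\<^sub>R x) \<le> norm (z + t *\<^sub>R x) + norm (z - t *\<^sub>R x)"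
    using norm_triangle_ineq4[of "z + t *\<^sub>R x" "z - t *\<^sub>R x"]
    by (simp flip: scaleR_add_left)
  ultimately have "2 * max (norm z) \<bar>t\<bar> \<le> norm (z + t *\<^sub>R x) + norm (z - t *\<^sub>R x)"
    using \<open>norm x = 1\<close> by (simp add: abs_mult)
  with upper show ?thesis
    unfolding left_diff_distrib distrib_right by linarith
qed

lemma bounded_linear_supfst:
  "bounded_linear (supfst :: ('a::real_normed_vector, 'b::real_normed_vector) sup_sum \<Rightarrow> 'a)"
  by (rule bounded_linear_intro[where K = 1]) (auto simp: norm_sup_sum_def)

lemma bounded_linear_SupPair_left:
  "bounded_linear (\<lambda>x::'a::real_normed_vector. SupPair x (0::'b::real_normed_vector))"
  by (rule bounded_linear_intro[where K = 1]) (auto simp: norm_sup_sum_def sup_sum_eq_iff)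

lemma ASQ_less_imp_almost_isometric_ideal:
  fixes \<kappa> :: "'k rel"
  assumes ASQ: "ASQ_less TYPE('a::banach) \<kappa>"
  shows "almost_isometric_ideal \<kappa> (range (\<lambda>x. SupPair x 0) :: ('a, real) sup_sum set)"
  unfolding almost_isometric_ideal_def
proof (intro conjI allI impI)
  show "subspace (range (\<lambda>x. SupPair x 0) :: ('a, real) sup_sum set)"
    using bounded_linear.linear[OF bounded_linear_SupPair_left] subspace_UNIV
    by (rule linear_subspace_image)
next
  fix E :: "('a, real) sup_sum set" and \<epsilon> :: real
  assume "subspace E \<and> dens E <o \<kappa> \<and> \<epsilon> > 0"
  then have E: "subspace E" "dens E <o \<kappa>" and \<epsilon>: "\<epsilon> > 0"
    by auto
  have "subspace (supfst ` E)"
    using bounded_linear.linear[OF bounded_linear_supfst] E(1) by (rule linear_subspace_image)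
  then obtain x :: 'a where x: "norm x = 1"
    and upper: "\<And>z t. z \<in> supfst ` E \<Longrightarrow> norm (z + t *\<^sub>R x) \<le> (1 + \<epsilon>) * max (norm z) \<bar>t\<bar>"
    using ASQ \<epsilon> dens_bounded_linear_image_less[OF bounded_linear_supfst E(2)]
    unfolding ASQ_less_def by (metis mem_sphere_0)
  have lower: "(1 - \<epsilon>) * max (norm z) \<bar>t\<bar> \<le> norm (z + t *\<^sub>R x)" if "z \<in> supfst ` E" for z t
    using x upper[OF that, of "- t"] by (intro norm_add_scaleR_ge) auto
  define T :: "('a, real) sup_sum \<Rightarrow> ('a, real) sup_sum"
    where "T e = SupPair (supfst e + supsnd e *\<^sub>R x) 0" for e
  have norm_T: "norm (T e) = norm (supfst e + supsnd e *\<^sub>R x)" for e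
    by (simp add: T_def norm_sup_sum_def)
  have "linear_operator_on E (range (\<lambda>x. SupPair x 0)) T"
    unfolding linear_operator_on_def by (auto simp: T_def sup_sum_eq_iff algebra_simps)
  moreover have "\<forall>e\<in>E. (1 - \<epsilon>) * norm e \<le> norm (T e) \<and> norm (T e) \<le> (1 + \<epsilon>) * norm e"
    unfolding norm_T using lower upper by (simp add: norm_sup_sum_def)
  moreover have "\<forall>e\<in>E \<inter> range (\<lambda>x. SupPair x 0). T e = e"
    by (auto simp: T_def)
  ultimately show "\<exists>T. linear_operator_on E (range (\<lambda>x. SupPair x 0)) T \<and>
      (\<forall>e\<in>E. (1 - \<epsilon>) * norm e \<le> norm (T e) \<and> norm (T e) \<le> (1 + \<epsilon>) * norm e) \<and>
      (\<forall>e\<in>E \<inter> range (\<lambda>x. SupPair x 0). T e = e)"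
    by blast
qed

lemma almost_isometric_ideal_imp_ASQ_less:
  fixes \<kappa> :: "'k rel"
  assumes \<kappa>: "Cinfinite \<kappa>"
    and ideal: "almost_isometric_ideal \<kappa> (range (\<lambda>x. SupPair x 0) :: ('a::banach, real) sup_sum set)"
  shows "ASQ_less TYPE('a) \<kappa>"
  unfolding ASQ_less_def
proof (intro allI impI)
  fix Z :: "'a set" and \<epsilon> :: real
  assume "subspace Z \<and> dens Z <o \<kappa> \<and> \<epsilon> > 0"
  then have Z: "subspace Z" "dens Z <o \<kappa>" and \<epsilon>: "\<epsilon> > 0"
    by auto
  let ?Y = "range (\<lambda>x. SupPair x 0) :: ('a, real) sup_sum set"
  let ?e = "SupPair 0 1 :: ('a, real) sup_sum"
  let ?Z0 = "(\<lambda>x. SupPair x 0) ` Z :: ('a, real) sup_sum set"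
  define E where "E = {z + w | z w. z \<in> ?Z0 \<and> w \<in> span {?e}}"
  have Z0: "subspace ?Z0"
    using bounded_linear.linear[OF bounded_linear_SupPair_left] Z(1) by (rule linear_subspace_image)
  have "subspace E"
    unfolding E_def by (intro subspace_sums Z0 subspace_span)
  moreover have "dens E <o \<kappa>"
    unfolding E_def
    by (intro dens_sum_less \<kappa> Z0 subspace_span dens_line_less
        dens_bounded_linear_image_less[OF bounded_linear_SupPair_left Z(2)])
  moreover
  \<comment> \<open>The solution of \<open>(1 + \<delta>) / (1 - \<delta>) = 1 + \<epsilon>\<close>.\<close>
  define \<delta> where "\<delta> = \<epsilon> / (2 + \<epsilon>)"
  have \<delta>: "0 < \<delta>" "\<delta> < 1" "1 + \<delta> = (1 + \<epsilon>) * (1 - \<delta>)"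
    using \<epsilon> by (simp_all add: \<delta>_def field_simps)
  ultimately obtain T where T: "linear_operator_on E ?Y T"
    and T_norm: "\<And>e. e \<in> E \<Longrightarrow> (1 - \<delta>) * norm e \<le> norm (T e) \<and> norm (T e) \<le> (1 + \<delta>) * norm e"
    and T_fix: "\<And>e. e \<in> E \<inter> ?Y \<Longrightarrow> T e = e"
    using ideal unfolding almost_isometric_ideal_def by meson
  have E_mem: "SupPair z t \<in> E" if "z \<in> Z" for z t
  proof -
    have "SupPair z t = SupPair z 0 + t *\<^sub>R ?e"
      by (simp add: sup_sum_eq_iff)
    moreover have "t *\<^sub>R ?e \<in> span {?e}"
      by (intro span_scale span_base) simp
    ultimately show ?thesis
      using that unfolding E_def by blast
  qed
  have e: "?e \<in> E"
    using E_mem[OF subspace_0[OF Z(1)]] .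
  obtain y where y: "T ?e = SupPair y 0"
    using T e unfolding linear_operator_on_def by auto
  have y_ge: "1 - \<delta> \<le> norm y"
    using T_norm[OF e] by (simp add: y norm_sup_sum_def)
  then have y_pos: "norm y > 0"
    using \<delta> by linarith
  have T_eq: "T (SupPair z t) = SupPair (z + t *\<^sub>R y) 0" if "z \<in> Z" for z t
  proof -
    have "SupPair z t = SupPair z 0 + t *\<^sub>R ?e"
      by (simp add: sup_sum_eq_iff)
    moreover have "t *\<^sub>R ?e \<in> E"
      using \<open>subspace E\<close> e by (rule subspace_scale)
    ultimately have "T (SupPair z t) = T (SupPair z 0) + t *\<^sub>R T ?e"
      using T e E_mem[OF that, of 0] unfolding linear_operator_on_def by metis
    also have "T (SupPair z 0) = SupPair z 0"
      using E_mem[OF that, of 0] by (intro T_fix) auto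
    finally show ?thesis
      by (simp add: y sup_sum_eq_iff)
  qed
  show "\<exists>x\<in>sphere 0 1. \<forall>z\<in>Z. \<forall>t::real. norm (z + t *\<^sub>R x) \<le> (1 + \<epsilon>) * max (norm z) \<bar>t\<bar>"
  proof (intro bexI ballI allI)
    show "sgn y \<in> sphere 0 1"
      using y_pos by (auto simp: norm_sgn)
    fix z t assume z: "z \<in> Z"
    let ?s = "t / norm y"
    have "norm (z + t *\<^sub>R sgn y) = norm (T (SupPair z ?s))"
      by (simp add: T_eq[OF z] norm_sup_sum_def sgn_div_norm divide_inverse)
    also have "\<dots> \<le> (1 + \<delta>) * max (norm z) \<bar>?s\<bar>"
      using T_norm[OF E_mem[OF z, of ?s]] by (simp add: norm_sup_sum_def)
    also have "\<dots> = (1 + \<epsilon>) * max ((1 - \<delta>) * norm z) ((1 - \<delta>) * \<bar>?s\<bar>)"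
      using \<epsilon> \<delta>(2) unfolding \<delta>(3) by (simp add: max_mult_distrib_left mult.assoc)
    also have "\<dots> \<le> (1 + \<epsilon>) * max (norm z) \<bar>t\<bar>"
    proof (intro mult_left_mono max.mono)
      show "(1 - \<delta>) * norm z \<le> norm z"
        using \<delta> by (intro mult_left_le_one_le) auto
      have "(1 - \<delta>) * \<bar>?s\<bar> \<le> norm y * \<bar>?s\<bar>"
        using y_ge by (rule mult_right_mono) simp
      then show "(1 - \<delta>) * \<bar>?s\<bar> \<le> \<bar>t\<bar>"
        using y_pos by (simp add: abs_divide)
    qed (use \<epsilon> in simp)
    finally show "norm (z + t *\<^sub>R sgn y) \<le> (1 + \<epsilon>) * max (norm z) \<bar>t\<bar>" .
  qed
qed

theorem theorem4p15:
  fixes \<kappa> :: "'k rel"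
  assumes "Cinfinite \<kappa>"
  shows "ASQ_less TYPE('a::banach) \<kappa> \<longleftrightarrow>
    almost_isometric_ideal \<kappa> (range (\<lambda>x. SupPair x 0) :: ('a, real) sup_sum set)"
  using ASQ_less_imp_almost_isometric_ideal almost_isometric_ideal_imp_ASQ_less[OF assms]
  by blast

end
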